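(* Let $\mathcal{C}$ be an $[n,k,d]_q$ MDS code of distance $d\ge 3$ and covering radius $R=d-2$, with a parity check matrix $H_{\mathcal{C}}$. Remove $\Delta$ columns from $H_{\mathcal{C}}$, where $1\le\Delta\le n-d$. Then the resulting matrix is a parity check matrix of an $[n-\Delta,k-\Delta,d]_q$ MDS code $\mathcal{C}_\Delta$ of covering radius $R_\Delta=d-1$. Moreover, all the weight $d-1$ cosets $\mathcal{V}^{(d-1)}$ of $\mathcal{C}_\Delta$ have the same weight distribution, namely $$B_w(\mathcal{V}^{(d-1)})=0\ \text{ if } w=0,1,\ldots,d-2;\qquad B_{d-1}(\mathcal{V}^{(d-1)})=\binom{n-\Delta}{d-1};$$ $$B_w(\mathcal{V}^{(d-1)})=A_w(\mathcal{C}_\Delta)-\Omega_w^{(0)}(n-\Delta,d)\ \text{ if } w=d,d+1,\ldots,n-\Delta.$$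
   Context: An $[n,k,d]_q$ code is a $k$-dimensional $\mathbb{F}_q$-linear subspace of $\mathbb{F}_q^n$ with minimum Hamming distance $d$; it is MDS if $d=n-k+1$. A parity check matrix of it is an $(n-k)\times n$ matrix whose right null space is the code. The covering radius is the least integer $R$ such that every vector of the ambient space is within Hamming distance $R$ of some codeword. A coset of a code is a translate of it; the weight of a coset is the smallest Hamming weight of a vector in it. $A_w(\mathcal{C})$ (resp. $B_w(\mathcal{V})$) is the number of vectors of Hamming weight $w$ in the code $\mathcal{C}$ (resp. in the coset $\mathcal{V}$). Notation: $\Omega_w^{(v)}(n,d)=(-1)^{w-d}\binom{n-v}{w-v}\binom{w-1-v}{d-2-v}$. *)

theory Defs
  imports "HOL-Library.Cardinality" "HOL-Algebra.AbelCoset" "Jordan_Normal_Form.Matrix_Kernel" "Jordan_Normal_Form.DL_Submatrix"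
begin

text \<open>The field with q elements is a type 'a of sort \<open>{field, finite}\<close> with \<open>CARD('a) = q\<close>.\<close>

definition hweight :: "'a::zero vec \<Rightarrow> nat" where
  "hweight v = card {i. i < dim_vec v \<and> v $ i \<noteq> 0}"

text \<open>Meant for vectors of equal length.\<close>

definition hdist :: "'a vec \<Rightarrow> 'a vec \<Rightarrow> nat" where
  "hdist u v = card {i. i < dim_vec u \<and> u $ i \<noteq> v $ i}"

text \<open>A relation rather than a function, since a code with fewer than two words has no minimum
  distance; in particular a code with these parameters is never the zero code.\<close>

definition has_min_dist :: "'a vec set \<Rightarrow> nat \<Rightarrow> bool" where
  "has_min_dist C d \<longleftrightarrow>
     (\<exists>u\<in>C. \<exists>v\<in>C. u \<noteq> v \<and> hdist u v = d) \<and>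
     (\<forall>u\<in>C. \<forall>v\<in>C. u \<noteq> v \<longrightarrow> d \<le> hdist u v)"

definition linear_code :: "nat \<Rightarrow> nat \<Rightarrow> nat \<Rightarrow> nat \<Rightarrow> 'a::{field,finite} vec set \<Rightarrow> bool" where
  "linear_code q n k d C \<longleftrightarrow>
     CARD('a) = q \<and>
     VectorSpace.subspace class_ring C (module_vec TYPE('a) n) \<and>
     vectorspace.dim class_ring ((module_vec TYPE('a) n)\<lparr>carrier := C\<rparr>) = k \<and>
     has_min_dist C d"

text \<open>The subtraction is never truncated, as a subspace has dimension at most n.\<close>

definition mds_code :: "nat \<Rightarrow> nat \<Rightarrow> nat \<Rightarrow> nat \<Rightarrow> 'a::{field,finite} vec set \<Rightarrow> bool" where
  "mds_code q n k d C \<longleftrightarrow> linear_code q n k d C \<and> d = n - k + 1"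

definition parity_check_matrix :: "nat \<Rightarrow> nat \<Rightarrow> 'a::field vec set \<Rightarrow> 'a mat \<Rightarrow> bool" where
  "parity_check_matrix n k C H \<longleftrightarrow> H \<in> carrier_mat (n - k) n \<and> mat_kernel H = C"

definition covering_radius :: "nat \<Rightarrow> 'a vec set \<Rightarrow> nat" where
  "covering_radius n C = (LEAST R. \<forall>x\<in>carrier_vec n. \<exists>c\<in>C. hdist x c \<le> R)"

definition code_cosets :: "nat \<Rightarrow> 'a::field vec set \<Rightarrow> 'a vec set set" where
  "code_cosets n C = a_rcosets\<^bsub>module_vec TYPE('a) n\<^esub> C"

definition coset_weight :: "'a::{zero,finite} vec set \<Rightarrow> nat" where
  "coset_weight V = Min (hweight ` V)"

text \<open>The number of vectors of weight w, both for a code (A) and for a coset (B).\<close>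

definition weight_count :: "nat \<Rightarrow> 'a::zero vec set \<Rightarrow> nat" where
  "weight_count w V = card {v \<in> V. hweight v = w}"

text \<open>\<open>Omega_w^(v)(n,d)\<close>, for \<open>v \<le> d - 2\<close> and \<open>w \<ge> d\<close>, where no subtraction is truncated.\<close>

definition Omega :: "nat \<Rightarrow> nat \<Rightarrow> nat \<Rightarrow> nat \<Rightarrow> int" where
  "Omega w v n d =
     (-1) ^ (w - d) * int ((n - v) choose (w - v)) * int ((w - 1 - v) choose (d - 2 - v))"

end

(* A matrix with r rows all of whose nonzero kernel vectors have weight > r has any r columns
   forming a basis. A removed column s is then independent of any r - 1 remaining ones, so every
   solution of A y = s has weight at least r = d - 1; this gives the covering radius.
   For a set T of positions, the kernel and a coset of weight r have equally many words
   supported in T once card T >= r (translate by a solution supported in T), while for card T < r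
   the kernel has only the zero word and the coset none. Inverting over subsets, the numbers of
   words with support exactly T differ by an amount depending only on card T. *)
theory Submission
  imports Defs
begin

section \<open>Inversion over subsets\<close>

lemma sum_Pow_insert:
  assumes "finite T" "x \<notin> T"
  shows "sum f (Pow (insert x T)) = (\<Sum>U\<in>Pow T. f U + f (insert x U))"
proof -
  have "inj_on (insert x) (Pow T)"
    using assms(2) by (auto simp: inj_on_def)
  then have "sum f (insert x ` Pow T) = (\<Sum>U\<in>Pow T. f (insert x U))"
    by (simp add: sum.reindex)
  moreover have "Pow T \<inter> insert x ` Pow T = {}"
    using assms(2) by auto
  ultimately show ?thesis
    using assms(1) by (simp add: Pow_insert sum.union_disjoint sum.distrib)
qed

text \<open>Moebius inversion in uniqueness form. Strong induction: the terms at proper subsets of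
  \<open>T\<close> already agree, so they cancel from the equation at \<open>T\<close> itself. Only
  cancellation is used, no explicit inversion formula.\<close>

lemma sum_Pow_determines:
  fixes f g :: "'b set \<Rightarrow> 'c::cancel_comm_monoid_add"
  assumes "finite T" "\<And>U. U \<subseteq> T \<Longrightarrow> sum f (Pow U) = sum g (Pow U)"
  shows "f T = g T"
  using assms
proof (induction T rule: finite_psubset_induct)
  case (psubset T)
  have "sum f (Pow T - {T}) = sum g (Pow T - {T})"
  proof (rule sum.cong)
    fix U assume "U \<in> Pow T - {T}"
    then show "f U = g U"
      using psubset.IH[of U] psubset.prems by (metis Diff_iff PowD insertI1 order_trans psubsetI)
  qed simp
  moreover have "sum f (Pow T) = f T + sum f (Pow T - {T})" "sum g (Pow T) = g T + sum g (Pow T - {T})"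
    using psubset.hyps by (simp_all add: sum.remove)
  ultimately show ?case
    using psubset.prems[of T] by simp
qed

text \<open>The Moebius inverse over subsets of the indicator of \<open>card T < r\<close>, where \<open>r\<close> is the first argument.
  The last case is the closed form of the alternating sum of the \<open>(i + 1) choose j\<close> over \<open>j \<le> k\<close>.\<close>

fun threshold_inverse :: "nat \<Rightarrow> nat \<Rightarrow> int" where
  "threshold_inverse 0 j = 0"
| "threshold_inverse (Suc k) 0 = 1"
| "threshold_inverse (Suc k) (Suc i) = (-1) ^ (i + k + 1) * int (i choose k)"

text \<open>Pascal's rule with alternating signs. It says what happens when a new element may or may
  not join a set of size \<open>j\<close>: the threshold drops by one.\<close>

lemma threshold_inverse_add_Suc:
  "threshold_inverse (Suc k) j + threshold_inverse (Suc k) (Suc j) = threshold_inverse k j"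
proof (cases k)
  case 0
  then show ?thesis by (cases j) auto
next
  case (Suc k')
  then show ?thesis by (cases j) (auto simp: algebra_simps)
qed

text \<open>Pairing \<open>U\<close> with \<open>insert x U\<close> and applying the recurrence
  turns threshold \<open>Suc k\<close> on \<open>insert x T\<close> into threshold \<open>k\<close>
  on \<open>T\<close>, and the indicators match because \<open>card (insert x T) < Suc k\<close> iff
  \<open>card T < k\<close>.\<close>

lemma sum_Pow_threshold_inverse:
  assumes "finite T"
  shows "(\<Sum>U\<in>Pow T. threshold_inverse r (card U)) = (if card T < r then 1 else 0)"
  using assms
proof (induction T arbitrary: r rule: finite_induct)
  case empty
  then show ?case by (cases r) auto
next
  case (insert x T)
  show ?case
  proof (cases r)
    case 0
    then show ?thesis by simp
  next
    case (Suc k)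
    have "(\<Sum>U\<in>Pow (insert x T). threshold_inverse r (card U))
        = (\<Sum>U\<in>Pow T. threshold_inverse r (card U) + threshold_inverse r (card (insert x U)))"
      by (rule sum_Pow_insert) (use insert in auto)
    also have "\<dots> = (\<Sum>U\<in>Pow T. threshold_inverse k (card U))"
    proof (rule sum.cong)
      fix U assume "U \<in> Pow T"
      then have "card (insert x U) = Suc (card U)"
        using insert.hyps by (meson PowD card_insert_disjoint finite_subset subsetD)
      then show "threshold_inverse r (card U) + threshold_inverse r (card (insert x U))
          = threshold_inverse k (card U)"
        by (simp only: Suc threshold_inverse_add_Suc)
    qed simp
    finally show ?thesis
      using insert.IH[of k] insert.hyps Suc by simp
  qed
qed

section \<open>Supports\<close>

definition vec_supp :: "'a::zero vec \<Rightarrow> nat set" where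
  "vec_supp v = {i. i < dim_vec v \<and> v $ i \<noteq> 0}"

definition vecs_on :: "nat \<Rightarrow> nat set \<Rightarrow> 'a::zero vec set" where
  "vecs_on m U = {y \<in> carrier_vec m. vec_supp y \<subseteq> U}"

lemma hweight_eq_card_supp: "hweight v = card (vec_supp v)"
  by (simp add: hweight_def vec_supp_def)

lemma vec_supp_subset: "v \<in> carrier_vec m \<Longrightarrow> vec_supp v \<subseteq> {..<m}"
  by (auto simp: vec_supp_def)

lemma finite_vec_supp [simp]: "finite (vec_supp v)"
  by (simp add: vec_supp_def)

lemma hweight_le: "v \<in> vecs_on m U \<Longrightarrow> finite U \<Longrightarrow> hweight v \<le> card U"
  by (simp add: hweight_eq_card_supp vecs_on_def card_mono)

lemma hweight_eq_0_iff: "v \<in> carrier_vec m \<Longrightarrow> hweight v = 0 \<longleftrightarrow> v = 0\<^sub>v m"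
  by (auto simp: hweight_eq_card_supp vec_supp_def)

lemma hdist_eq_hweight:
  fixes u v :: "'a::group_add vec"
  assumes "u \<in> carrier_vec m" "v \<in> carrier_vec m"
  shows "hdist u v = hweight (u - v)"
proof -
  have "{i. i < dim_vec u \<and> u $ i \<noteq> v $ i} = {i. i < dim_vec (u - v) \<and> (u - v) $ i \<noteq> 0}"
    using assms by auto
  then show ?thesis by (simp add: hdist_def hweight_def)
qed

lemma vecs_on_add:
  fixes x y :: "'a::monoid_add vec"
  shows "x \<in> vecs_on m U \<Longrightarrow> y \<in> vecs_on m U \<Longrightarrow> x + y \<in> vecs_on m U"
  by (fastforce simp: vecs_on_def vec_supp_def)

lemma vecs_on_diff:
  fixes x y :: "'a::group_add vec"
  shows "x \<in> vecs_on m U \<Longrightarrow> y \<in> vecs_on m U \<Longrightarrow> x - y \<in> vecs_on m U"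
  by (fastforce simp: vecs_on_def vec_supp_def)

lemma finite_carrier_vec [simp]: "finite (carrier_vec m :: 'a::finite vec set)"
proof (rule finite_subset)
  show "carrier_vec m \<subseteq> vec m ` ({..<m} \<rightarrow>\<^sub>E (UNIV :: 'a set))"
  proof
    fix v :: "'a vec" assume v: "v \<in> carrier_vec m"
    have "v = vec m (restrict (($) v) {..<m})"
      using v by auto
    then show "v \<in> vec m ` ({..<m} \<rightarrow>\<^sub>E UNIV)"
      by (metis UNIV_I image_eqI restrict_PiE_iff)
  qed
  show "finite (vec m ` ({..<m} \<rightarrow>\<^sub>E (UNIV :: 'a set)))"
    by (simp add: finite_PiE)
qed

text \<open>Restriction to \<open>U\<close> identifies these vectors with the functions on
  \<open>U\<close>. The count later turns injectivity of a matrix map into surjectivity.\<close>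

lemma card_vecs_on:
  assumes U: "U \<subseteq> {..<m}"
  shows "card (vecs_on m U :: 'a::{zero,finite} vec set) = CARD('a) ^ card U"
proof -
  let ?F = "\<lambda>f :: nat \<Rightarrow> 'a. vec m (\<lambda>i. if i \<in> U then f i else 0)"
  have "bij_betw ?F (U \<rightarrow>\<^sub>E UNIV) (vecs_on m U)"
  proof (rule bij_betwI[where g = "\<lambda>v. restrict (($) v) U"])
    show "?F \<in> (U \<rightarrow>\<^sub>E UNIV) \<rightarrow> vecs_on m U"
      by (auto simp: vecs_on_def vec_supp_def split: if_splits)
    show "(\<lambda>v. restrict (($) v) U) \<in> vecs_on m U \<rightarrow> (U \<rightarrow>\<^sub>E UNIV)"
      by auto
    show "restrict (($) (?F f)) U = f" if "f \<in> U \<rightarrow>\<^sub>E UNIV" for f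
    proof
      fix i show "restrict (($) (?F f)) U i = f i"
        using U PiE_arb[OF that, of i] by (cases "i \<in> U") auto
    qed
    show "?F (restrict (($) v) U) = v" if "v \<in> vecs_on m U" for v
      using that by (intro eq_vecI) (auto simp: vecs_on_def vec_supp_def)
  qed
  then have "card (vecs_on m U :: 'a vec set) = card (U \<rightarrow>\<^sub>E (UNIV :: 'a set))"
    by (rule bij_betw_same_card[symmetric])
  also have "\<dots> = CARD('a) ^ card U"
    using finite_subset[OF U] by (simp add: card_PiE)
  finally show ?thesis .
qed

lemma vecs_on_full: "vecs_on m {..<m} = carrier_vec m"
  using vec_supp_subset by (auto simp: vecs_on_def)

section \<open>Matrices whose kernel is an MDS code\<close>

text \<open>The vectors with syndrome \<open>s\<close>. The nonempty fibers are exactly the cosets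
  of the kernel.\<close>

definition fiber :: "'a::comm_ring_1 mat \<Rightarrow> 'a vec \<Rightarrow> 'a vec set" where
  "fiber A s = {y \<in> carrier_vec (dim_col A). A *\<^sub>v y = s}"

lemma fiber_zero: "A \<in> carrier_mat r m \<Longrightarrow> fiber A (0\<^sub>v r) = mat_kernel A"
  by (auto simp: fiber_def mat_kernel_def)

text \<open>Equivalently, any at most \<open>r\<close> columns are linearly independent. Phrased
  through weights, the condition passes to submatrices without computing a dimension, and it allows
  a trivial kernel.\<close>

locale mds_matrix =
  fixes r m :: nat and A :: "'a::{field,finite} mat"
  assumes A: "A \<in> carrier_mat r m"
    and kernel_weight: "y \<in> mat_kernel A \<Longrightarrow> y \<noteq> 0\<^sub>v m \<Longrightarrow> r < hweight y"
begin

section \<open>Solving linear systems on prescribed positions\<close>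

lemma mult_diff:
  "x \<in> carrier_vec m \<Longrightarrow> y \<in> carrier_vec m \<Longrightarrow> A *\<^sub>v (x - y) = A *\<^sub>v x - A *\<^sub>v y"
  using A by (rule mult_minus_distrib_mat_vec)

lemma mult_add:
  "x \<in> carrier_vec m \<Longrightarrow> y \<in> carrier_vec m \<Longrightarrow> A *\<^sub>v (x + y) = A *\<^sub>v x + A *\<^sub>v y"
  using A by (rule mult_add_distrib_mat_vec)

lemma kernel_vecs_on_eq_0:
  assumes "finite U" "card U \<le> r" "y \<in> vecs_on m U" "y \<in> mat_kernel A"
  shows "y = 0\<^sub>v m"
  using assms kernel_weight[of y] hweight_le[of y m U] by linarith

text \<open>Two vectors on \<open>U\<close> with the same image differ by a kernel vector of weight
  at most \<open>r\<close>, hence by zero. An injective map between sets of equal size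
  \<open>CARD('a) ^ r\<close> is onto.\<close>

lemma image_vecs_on:
  assumes U: "U \<subseteq> {..<m}" "card U = r"
  shows "(*\<^sub>v) A ` vecs_on m U = carrier_vec r"
proof (rule card_subset_eq)
  have fin: "finite U" using U finite_subset by blast
  show "(*\<^sub>v) A ` vecs_on m U \<subseteq> carrier_vec r"
    using A by (auto simp: vecs_on_def)
  have "inj_on ((*\<^sub>v) A) (vecs_on m U)"
  proof (rule inj_onI)
    fix x y assume xy: "x \<in> vecs_on m U" "y \<in> vecs_on m U" "A *\<^sub>v x = A *\<^sub>v y"
    then have c: "x \<in> carrier_vec m" "y \<in> carrier_vec m" by (auto simp: vecs_on_def)
    then have "A *\<^sub>v (x - y) = 0\<^sub>v r"
      using A xy(3) by (simp add: mult_diff)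
    then have "x - y \<in> mat_kernel A"
      using A c by (intro mat_kernelI) auto
    then have "x - y = 0\<^sub>v m"
      using kernel_vecs_on_eq_0 fin U(2) vecs_on_diff xy by blast
    then have "(x - y) $ i = 0" if "i < m" for i using that by simp
    then show "x = y" using c by (intro eq_vecI) auto
  qed
  then have "card ((*\<^sub>v) A ` vecs_on m U) = CARD('a) ^ r"
    using U by (simp add: card_image card_vecs_on)
  then show "card ((*\<^sub>v) A ` vecs_on m U) = card (carrier_vec r :: 'a vec set)"
    using card_vecs_on[of "{..<r}" r, where 'a = 'a] by (simp add: vecs_on_full)
qed simp

text \<open>Shrinking \<open>U\<close> to exactly \<open>r\<close> positions leaves the system
  solvable and bounds the weight of the solution.\<close>

lemma obtain_preimage:
  assumes "U \<subseteq> {..<m}" "r \<le> card U" "s \<in> carrier_vec r"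
  obtains y where "y \<in> vecs_on m U" "A *\<^sub>v y = s" "hweight y \<le> r"
proof -
  obtain U' where U': "U' \<subseteq> U" "card U' = r" "finite U'"
    using assms(2) by (metis obtain_subset_with_card_n)
  then obtain y where "y \<in> vecs_on m U'" "A *\<^sub>v y = s"
    using image_vecs_on[of U'] assms by (smt (verit) imageE order_trans)
  with U' show ?thesis
    using that[of y] hweight_le[of y m U'] by (auto simp: vecs_on_def)
qed

section \<open>Parameters and covering radius of the kernel code\<close>

text \<open>Rank-nullity: for \<open>r \<le> m\<close> every syndrome is attained, so the rank is
  \<open>r\<close>.\<close>

lemma dim_kernel:
  assumes "r \<le> m"
  shows "vectorspace.dim class_ring ((module_vec TYPE('a) m)\<lparr>carrier := mat_kernel A\<rparr>) = m - r"
proof -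
  interpret V: vec_space "TYPE('a)" m .
  interpret W: vec_space "TYPE('a)" r .
  have hom: "(*\<^sub>v) A \<in> LinearCombinations.module_hom class_ring (module_vec TYPE('a) m) (module_vec TYPE('a) r)"
    using A by (auto simp: LinearCombinations.module_hom_def module_vec_simps mult_add mult_mat_vec)
  interpret T: linear_map class_ring "module_vec TYPE('a) m" "module_vec TYPE('a) r" "(*\<^sub>v) A"
    by (intro linear_map.intro mod_hom.intro mod_hom_axioms.intro hom
        V.vectorspace_axioms W.vectorspace_axioms V.module_axioms W.module_axioms)
  have ker: "T.kerT = mat_kernel A"
    using A by (auto simp: T.ker_def mat_kernel module_vec_simps)
  have "(*\<^sub>v) A ` carrier_vec m = carrier_vec r"
  proof
    show "(*\<^sub>v) A ` carrier_vec m \<subseteq> carrier_vec r" using A by auto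
    show "carrier_vec r \<subseteq> (*\<^sub>v) A ` carrier_vec m"
    proof
      fix s :: "'a vec" assume "s \<in> carrier_vec r"
      then obtain y where "y \<in> carrier_vec m" "A *\<^sub>v y = s"
        using obtain_preimage[of "{..<m}" s] assms by (auto simp: vecs_on_full)
      then show "s \<in> (*\<^sub>v) A ` carrier_vec m" by blast
    qed
  qed
  then have "T.imT = carrier (module_vec TYPE('a) r)"
    by (simp add: T.im_def module_vec_simps)
  then have "vectorspace.dim class_ring (W.vs T.imT) = r"
  proof (simp only:)
    have "W.vs (carrier (module_vec TYPE('a) r)) = module_vec TYPE('a) r" by simp
    then show "vectorspace.dim class_ring (W.vs (carrier (module_vec TYPE('a) r))) = r"
      using W.dim_is_n by (simp only:)
  qed
  moreover have "vectorspace.dim class_ring (W.vs T.imT) + vectorspace.dim class_ring (V.vs T.kerT) = m"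
    using T.rank_nullity[OF V.fin_dim] V.dim_is_n by simp
  ultimately show ?thesis by (simp add: ker)
qed

lemma subspace_kernel: "VectorSpace.subspace class_ring (mat_kernel A) (module_vec TYPE('a) m)"
proof -
  interpret V: vec_space "TYPE('a)" m .
  show ?thesis
    by unfold_locales
      (use A in \<open>auto simp: mat_kernel module_vec_simps mult_add mult_mat_vec\<close>)
qed

lemma has_min_dist_kernel:
  assumes "r < m"
  shows "has_min_dist (mat_kernel A) (r + 1)"
proof -
  have zero: "0\<^sub>v m \<in> mat_kernel A"
    using A by (intro mat_kernelI) auto
  have car: "u \<in> carrier_vec m" if "u \<in> mat_kernel A" for u
    using that mat_kernel_carrier[OF A] by auto
  have lower: "r + 1 \<le> hdist u v" if "u \<in> mat_kernel A" "v \<in> mat_kernel A" "u \<noteq> v" for u v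
  proof -
    have c: "u \<in> carrier_vec m" "v \<in> carrier_vec m" using that car by auto
    have "A *\<^sub>v (u - v) = 0\<^sub>v r"
      using that mat_kernelD(2)[OF A] by (simp add: mult_diff c)
    then have "u - v \<in> mat_kernel A"
      using A c by (intro mat_kernelI) auto
    moreover have "u - v \<noteq> 0\<^sub>v m"
    proof
      assume "u - v = 0\<^sub>v m"
      then have "(u - v) $ i = 0" if "i < m" for i using that by simp
      then have "u = v" using c by (intro eq_vecI) auto
      with that show False by simp
    qed
    ultimately show ?thesis
      using kernel_weight[of "u - v"] by (simp add: hdist_eq_hweight[OF c])
  qed
  \<comment> \<open>Column \<open>r\<close>, the first one outside \<open>{..<r}\<close>, is a
    combination of the columns \<open>0\<close> to \<open>r - 1\<close>. This dependency among
    \<open>r + 1\<close> columns yields a kernel word \<open>u\<close> attaining the bound.\<close>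
  obtain y where y: "y \<in> vecs_on m {..<r}" "A *\<^sub>v y = A *\<^sub>v unit_vec m r"
    using obtain_preimage[of "{..<r}" "A *\<^sub>v unit_vec m r"] assms A by auto
  define u where "u = unit_vec m r - y"
  have c: "y \<in> carrier_vec m" "u \<in> carrier_vec m" using y by (auto simp: vecs_on_def u_def)
  have "u \<in> mat_kernel A"
    using A c y by (intro mat_kernelI) (auto simp: u_def mult_diff)
  \<comment> \<open>Since \<open>y\<close> vanishes at \<open>r\<close>, the entry of
    \<open>u\<close> there is 1, so \<open>u\<close> is nonzero.\<close>
  moreover have "r \<notin> vec_supp y"
    using y(1) by (auto simp: vecs_on_def)
  then have "y $ r = 0"
    using c assms by (auto simp: vec_supp_def)
  then have "u $ r \<noteq> (0\<^sub>v m :: 'a vec) $ r"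
    using assms c by (simp add: u_def)
  then have "u \<noteq> 0\<^sub>v m" by metis
  moreover have "u \<in> vecs_on m {..r}"
    unfolding u_def by (rule vecs_on_diff)
      (use y in \<open>auto simp: vecs_on_def vec_supp_def unit_vec_def split: if_splits\<close>)
  then have "hweight u \<le> r + 1"
    using hweight_le[of u m "{..r}"] by simp
  then have "hdist u (0\<^sub>v m) \<le> r + 1"
    using c by (simp add: hdist_eq_hweight[of u m])
  ultimately have "hdist u (0\<^sub>v m) = r + 1"
    using lower[of u "0\<^sub>v m"] zero by simp
  then show ?thesis
    unfolding has_min_dist_def using lower zero \<open>u \<in> mat_kernel A\<close> \<open>u \<noteq> 0\<^sub>v m\<close> by blast
qed

lemma mds_code_kernel:
  assumes "r < m" "r \<ge> 1"
  shows "mds_code CARD('a) m (m - r) (r + 1) (mat_kernel A)"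
  using assms by (simp add: mds_code_def linear_code_def subspace_kernel dim_kernel has_min_dist_kernel[simplified])

text \<open>Upper bound: some \<open>y\<close> of weight at most \<open>r\<close> has the syndrome
  of \<open>x\<close>, and \<open>x - y\<close> is a codeword at distance \<open>hweight y\<close>
  from \<open>x\<close>. Lower bound: if \<open>x\<close> has syndrome \<open>s\<close>, so does
  \<open>x - c\<close> for every codeword \<open>c\<close>, and \<open>far\<close> bounds its
  weight.\<close>

lemma covering_radius_kernel:
  assumes "r \<le> m" and s: "s \<in> carrier_vec r" and far: "\<And>y. y \<in> fiber A s \<Longrightarrow> r \<le> hweight y"
  shows "covering_radius m (mat_kernel A) = r"
  unfolding covering_radius_def
proof (rule Least_equality)
  show "\<forall>x\<in>carrier_vec m. \<exists>c\<in>mat_kernel A. hdist x c \<le> r"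
  proof
    fix x :: "'a vec" assume x: "x \<in> carrier_vec m"
    obtain y where y: "y \<in> vecs_on m {..<m}" "A *\<^sub>v y = A *\<^sub>v x" "hweight y \<le> r"
      using obtain_preimage[of "{..<m}" "A *\<^sub>v x"] assms A x by auto
    then have yc: "y \<in> carrier_vec m" by (simp add: vecs_on_full)
    have "x - y \<in> mat_kernel A"
      using A x yc y(2) by (intro mat_kernelI) (auto simp: mult_diff)
    moreover have "x - (x - y) = y" using x yc by (intro eq_vecI) auto
    then have "hdist x (x - y) = hweight y"
      using x yc hdist_eq_hweight[of x m "x - y"] by simp
    ultimately show "\<exists>c\<in>mat_kernel A. hdist x c \<le> r" using y(3) by (intro bexI) auto
  qed
next
  fix R assume R: "\<forall>x\<in>carrier_vec m. \<exists>c\<in>mat_kernel A. hdist x c \<le> R"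
  obtain x where x: "x \<in> carrier_vec m" "A *\<^sub>v x = s"
    using obtain_preimage[of "{..<m}" s] assms(1) s by (auto simp: vecs_on_full)
  then obtain c where c: "c \<in> mat_kernel A" "hdist x c \<le> R" using R by auto
  have cc: "c \<in> carrier_vec m" "A *\<^sub>v c = 0\<^sub>v r" using mat_kernelD[OF A c(1)] by auto
  have "A *\<^sub>v (x - c) = s"
    using x cc s by (simp add: mult_diff) 
  then have "x - c \<in> fiber A s" using A x cc by (auto simp: fiber_def)
  then show "r \<le> R"
    using far c(2) hdist_eq_hweight[OF x(1) cc(1)] by fastforce
qed

section \<open>Weight distribution of the cosets of weight \<open>r\<close>\<close>

text \<open>Vectors lie in the same coset iff their difference is in the kernel, that is, iff their
  syndromes agree; the coset of \<open>x\<close> is the fiber over the syndrome of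
  \<open>x\<close>.\<close>

lemma coset_eq_fiber:
  assumes "V \<in> code_cosets m (mat_kernel A)"
  obtains s where "s \<in> carrier_vec r" "V = fiber A s"
proof -
  from assms obtain x where x: "x \<in> carrier_vec m" "V = (\<Union>h\<in>mat_kernel A. {h + x})"
    by (auto simp: code_cosets_def A_RCOSETS_def' a_r_coset_def' module_vec_simps)
  have "V = fiber A (A *\<^sub>v x)"
  proof
    show "V \<subseteq> fiber A (A *\<^sub>v x)"
      using x A by (auto simp: fiber_def mat_kernel mult_add)
    show "fiber A (A *\<^sub>v x) \<subseteq> V"
    proof
      fix y assume y: "y \<in> fiber A (A *\<^sub>v x)"
      then have yc: "y \<in> carrier_vec m" "A *\<^sub>v y = A *\<^sub>v x" using A by (auto simp: fiber_def)
      then have "y - x \<in> mat_kernel A"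
        using A x by (intro mat_kernelI) (auto simp: mult_diff)
      moreover have "y = (y - x) + x" using yc x by (intro eq_vecI) auto
      ultimately show "y \<in> V" unfolding x(2) by blast
    qed
  qed
  with that[of "A *\<^sub>v x"] A x show ?thesis by auto
qed

lemma finite_fiber [simp]: "finite (fiber A s)"
  by (rule finite_subset[of _ "carrier_vec (dim_col A)"]) (auto simp: fiber_def)

text \<open>Refines the count by exact support, the quantity to which inversion over subsets
  applies.\<close>

lemma weight_count_fiber:
  "weight_count w (fiber A s)
    = (\<Sum>T | T \<subseteq> {..<m} \<and> card T = w. card {y \<in> fiber A s. vec_supp y = T})"
proof -
  have "{y \<in> fiber A s. hweight y = w}
      = (\<Union>T\<in>{T. T \<subseteq> {..<m} \<and> card T = w}. {y \<in> fiber A s. vec_supp y = T})"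
    using A vec_supp_subset by (fastforce simp: fiber_def hweight_eq_card_supp)
  then show ?thesis
    unfolding weight_count_def by (simp only:) (subst card_UN_disjoint, auto)
qed

lemma sum_Pow_card_fiber:
  assumes "T \<subseteq> {..<m}"
  shows "(\<Sum>U\<in>Pow T. card {y \<in> fiber A s. vec_supp y = U}) = card (fiber A s \<inter> vecs_on m T)"
proof -
  have "fiber A s \<inter> vecs_on m T = (\<Union>U\<in>Pow T. {y \<in> fiber A s. vec_supp y = U})"
    using A by (auto simp: fiber_def vecs_on_def)
  moreover have "finite T" using assms finite_subset by blast
  ultimately show ?thesis
    by (simp only:) (subst card_UN_disjoint, auto)
qed

lemma card_fiber_vecs_on_eq:
  assumes "T \<subseteq> {..<m}" "r \<le> card T" "s \<in> carrier_vec r"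
  shows "card (fiber A s \<inter> vecs_on m T) = card (mat_kernel A \<inter> vecs_on m T)"
proof -
  obtain z where z: "z \<in> vecs_on m T" "A *\<^sub>v z = s"
    using obtain_preimage assms by metis
  have zc: "z \<in> carrier_vec m" using z by (simp add: vecs_on_def)
  have "bij_betw (\<lambda>y. y - z) (fiber A s \<inter> vecs_on m T) (mat_kernel A \<inter> vecs_on m T)"
  proof (rule bij_betwI[where g = "\<lambda>y. y + z"])
    show "(\<lambda>y. y - z) \<in> fiber A s \<inter> vecs_on m T \<rightarrow> mat_kernel A \<inter> vecs_on m T"
      using A z zc assms(3) vecs_on_diff by (auto simp: fiber_def mat_kernel mult_diff)
    show "(\<lambda>y. y + z) \<in> mat_kernel A \<inter> vecs_on m T \<rightarrow> fiber A s \<inter> vecs_on m T"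
      using A z zc assms(3) vecs_on_add by (auto simp: fiber_def mat_kernel mult_add)
  qed (use zc in \<open>auto simp: vecs_on_def\<close>)
  then show ?thesis by (rule bij_betw_same_card)
qed

lemma card_supp_diff:
  assumes T: "T \<subseteq> {..<m}" and s: "s \<in> carrier_vec r"
    and far: "\<And>y. y \<in> fiber A s \<Longrightarrow> r \<le> hweight y"
  shows "int (card {y \<in> mat_kernel A. vec_supp y = T}) - int (card {y \<in> fiber A s. vec_supp y = T})
    = threshold_inverse r (card T)"
proof -
  have fin: "finite U" if "U \<subseteq> {..<m}" for U using that finite_subset by blast
  show ?thesis
  proof (rule sum_Pow_determines[where T = T])
    show "finite T" using fin T .
    fix U assume "U \<subseteq> T"
    with T have U: "U \<subseteq> {..<m}" by auto
    have "(\<Sum>X\<in>Pow U. int (card {y \<in> mat_kernel A. vec_supp y = X})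
          - int (card {y \<in> fiber A s. vec_supp y = X}))
        = int (card (mat_kernel A \<inter> vecs_on m U)) - int (card (fiber A s \<inter> vecs_on m U))"
      \<comment> \<open>The kernel is the fiber over zero, so the same subset-sum identity serves
        both terms.\<close>
      using sum_Pow_card_fiber[OF U, of s] sum_Pow_card_fiber[OF U, of "0\<^sub>v r"]
      by (simp add: sum_subtractf fiber_zero[OF A] flip: of_nat_sum)
    also have "\<dots> = (if card U < r then 1 else 0)"
    proof (cases "card U < r")
      \<comment> \<open>Too few positions for a word of weight \<open>r\<close>: the fiber
        contributes nothing and the kernel only its zero word, whence the difference 1.\<close>
      case True
      have "y \<notin> fiber A s" if "y \<in> vecs_on m U" for y
        using far[of y] hweight_le[OF that fin[OF U]] True by auto
      then have "fiber A s \<inter> vecs_on m U = {}" by auto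
      moreover have "mat_kernel A \<inter> vecs_on m U = {0\<^sub>v m}"
        using kernel_vecs_on_eq_0[OF fin[OF U]] True A
        by (auto simp: mat_kernel vecs_on_def vec_supp_def)
      ultimately show ?thesis using True by simp
    next
      case False
      then show ?thesis using card_fiber_vecs_on_eq[OF U _ s] by simp
    qed
    also have "\<dots> = (\<Sum>X\<in>Pow U. threshold_inverse r (card X))"
      using sum_Pow_threshold_inverse[OF fin[OF U]] by simp
    finally show "(\<Sum>X\<in>Pow U. int (card {y \<in> mat_kernel A. vec_supp y = X})
          - int (card {y \<in> fiber A s. vec_supp y = X}))
        = (\<Sum>X\<in>Pow U. threshold_inverse r (card X))" .
  qed
qed

text \<open>The difference at a single support depends only on its size, so all
  \<open>m choose w\<close> supports of size \<open>w\<close> contribute equally.\<close>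

lemma weight_count_diff:
  assumes s: "s \<in> carrier_vec r" and far: "\<And>y. y \<in> fiber A s \<Longrightarrow> r \<le> hweight y"
  shows "int (weight_count w (mat_kernel A)) - int (weight_count w (fiber A s))
    = int (m choose w) * threshold_inverse r w"
proof -
  have "int (weight_count w (mat_kernel A)) - int (weight_count w (fiber A s))
      = (\<Sum>T | T \<subseteq> {..<m} \<and> card T = w. threshold_inverse r w)"
    unfolding weight_count_fiber fiber_zero[OF A, symmetric] of_nat_sum sum_subtractf[symmetric]
    by (rule sum.cong) (auto simp: card_supp_diff[OF _ s far] fiber_zero[OF A])
  then show ?thesis by (simp add: n_subsets)
qed

text \<open>Nonzero kernel words weigh more than \<open>r\<close>, and \<open>r \<ge> 1\<close>
  rules out the zero word.\<close>

lemma weight_count_kernel_r: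
  assumes "r \<ge> 1"
  shows "weight_count r (mat_kernel A) = 0"
proof -
  have "hweight y \<noteq> r" if "y \<in> mat_kernel A" for y
    using kernel_weight[OF that] hweight_eq_0_iff[of y m] mat_kernelD(1)[OF A that] assms by auto
  then have "{y \<in> mat_kernel A. hweight y = r} = {}" by blast
  then show ?thesis by (simp only: weight_count_def card.empty)
qed

lemma weight_distribution:
  assumes "r \<ge> 1" and V: "V \<in> code_cosets m (mat_kernel A)" and wt: "coset_weight V = r"
  shows "w < r \<Longrightarrow> weight_count w V = 0"
    and "weight_count r V = m choose r"
    and "w > r \<Longrightarrow> int (weight_count w V) = int (weight_count w (mat_kernel A)) - Omega w 0 m (r + 1)"
proof -
  obtain s where s: "s \<in> carrier_vec r" "V = fiber A s" using coset_eq_fiber[OF V] .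
  have far: "r \<le> hweight y" if "y \<in> fiber A s" for y
    using wt that by (auto simp: coset_weight_def s(2))
  obtain k where k: "r = Suc k" using assms(1) by (cases r) auto
  note diff = weight_count_diff[OF s(1) far]
  show "weight_count w V = 0" if "w < r"
  proof -
    have "{y \<in> V. hweight y = w} = {}" using far that s(2) by fastforce
    then show ?thesis by (simp only: weight_count_def card.empty)
  qed
  show "weight_count r V = m choose r"
    \<comment> \<open>Here \<open>threshold_inverse r r = -1\<close>, and the kernel has no word of
      weight \<open>r\<close>.\<close>
    using diff[of r] weight_count_kernel_r[OF assms(1)] by (simp add: s(2) k)
  show "int (weight_count w V) = int (weight_count w (mat_kernel A)) - Omega w 0 m (r + 1)" if "w > r"
  proof -
    obtain i where w: "w = Suc (r + i)" using less_imp_Suc_add \<open>w > r\<close> by blast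
    \<comment> \<open>With \<open>w = r + 1 + i\<close> and \<open>r = k + 1\<close>, the exponent
      in \<open>threshold_inverse\<close> is \<open>i + 2 * (k + 1)\<close>, while the one in
      \<open>Omega\<close> is \<open>w - (r + 1) = i\<close>; the parities agree.\<close>
    have sign: "(-1 :: int) ^ (Suc k + i + k + 1) = (-1) ^ i"
      by (simp add: uminus_power_if)
    have "threshold_inverse r w = (-1) ^ i * int ((Suc k + i) choose k)"
      by (simp only: k w threshold_inverse.simps sign)
    moreover have "Omega w 0 m (r + 1) = (-1) ^ i * int (m choose w) * int ((Suc k + i) choose k)"
      by (simp add: Omega_def w k mult_ac)
    ultimately show ?thesis
      using diff[of w] by (simp add: s(2) mult_ac)
  qed
qed

end

section \<open>Removing columns\<close>

text \<open>Translates column indices of the submatrix into those of the original matrix. The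
  complement is taken in all naturals, hence infinite; exactly \<open>n - card S\<close> of its
  elements lie below \<open>n\<close>, and \<open>pick\<close> lists these first.\<close>

lemma bij_betw_pick_Compl:
  assumes "S \<subseteq> {..<n}"
  shows "bij_betw (pick (- S)) {..<n - card S} ({..<n} - S)"
proof -
  have fin: "finite S" using assms finite_subset by blast
  then have inf: "infinite (- S)" by (simp add: Compl_eq_Diff_UNIV)
  have inj: "inj_on (pick (- S)) {..<n - card S}"
    using pick_eq_iff_inf[OF inf] by (auto simp: inj_on_def)
  have card: "card ({..<n} - S) = n - card S"
    using assms fin by (simp add: card_Diff_subset)
  have "{i. i < n \<and> i \<in> - S} = {..<n} - S" by auto
  then have "pick (- S) l < n" if "l < n - card S" for l
    using pick_le[of l n "- S"] card that by simp
  then have "pick (- S) ` {..<n - card S} \<subseteq> {..<n} - S"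
    using pick_in_set_inf[OF inf] by auto
  then have "pick (- S) ` {..<n - card S} = {..<n} - S"
    by (intro card_subset_eq) (auto simp: card_image[OF inj] card)
  with inj show ?thesis by (simp add: bij_betw_def)
qed

text \<open>Filling in zeros at \<open>S\<close> embeds the kernel of the submatrix into that of
  \<open>H\<close> with weights preserved: it is the code shortened at \<open>S\<close>. A solution
  for a removed column \<open>s\<close> becomes a kernel word of \<open>H\<close> once the unit
  vector at \<open>s\<close> is subtracted, which raises the weight by at most one.\<close>

lemma remove_columns:
  assumes H: "mds_matrix r n H" and S: "S \<subseteq> {..<n}"
  shows "mds_matrix r (n - card S) (submatrix H UNIV (- S))"
    and "s \<in> S \<Longrightarrow> y \<in> fiber (submatrix H UNIV (- S)) (col H s) \<Longrightarrow> r \<le> hweight y"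
proof -
  interpret mds_matrix r n H by fact
  let ?m = "n - card S" and ?A = "submatrix H UNIV (- S)" and ?p = "pick (- S)"
  have bij: "bij_betw ?p {..<?m} ({..<n} - S)" by (rule bij_betw_pick_Compl[OF S])
  have fin: "finite S" using S finite_subset by blast
  then have inf: "infinite (- S)" by (simp add: Compl_eq_Diff_UNIV)
  have pn: "?p j < n" "?p j \<notin> S" if "j < ?m" for j
    using bij that by (auto simp: bij_betw_def)
  have "{i. i < n \<and> i \<in> - S} = {..<n} - S" by auto
  then have cn: "card {i. i < n \<and> i \<in> - S} = ?m"
    using S fin by (simp add: card_Diff_subset)
  have A': "?A \<in> carrier_mat r ?m"
    using A cn by (auto simp: dim_submatrix)
  have A'_index: "?A $$ (i, j) = H $$ (i, ?p j)" if "i < r" "j < ?m" for i j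
    using that A cn by (subst submatrix_index) (auto simp: pick_UNIV)
  \<comment> \<open>The number of kept positions below \<open>j\<close> is the index of column
    \<open>j\<close> in the submatrix, inverting \<open>pick\<close>.\<close>
  define emb :: "'a vec \<Rightarrow> 'a vec" where
    "emb y = vec n (\<lambda>j. if j \<in> S then 0 else y $ card {a \<in> - S. a < j})" for y
  have emb_carrier: "emb y \<in> carrier_vec n" for y by (simp add: emb_def)
  have emb_pick: "emb y $ ?p j = y $ j" if "j < ?m" for y j
    using pn[OF that] card_pick_inf[OF inf, of j] by (simp add: emb_def)
  have emb_mult: "H *\<^sub>v emb y = ?A *\<^sub>v y" if y: "y \<in> carrier_vec ?m" for y
  proof (rule eq_vecI)
    show "dim_vec (H *\<^sub>v emb y) = dim_vec (?A *\<^sub>v y)" using A A' by simp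
    fix i assume "i < dim_vec (?A *\<^sub>v y)"
    then have i: "i < r" using A' by simp
    have "(H *\<^sub>v emb y) $ i = (\<Sum>j\<in>{..<n}. H $$ (i, j) * emb y $ j)"
      using A i by (simp add: scalar_prod_def emb_def atLeast0LessThan)
    also have "\<dots> = (\<Sum>j\<in>{..<n} - S. H $$ (i, j) * emb y $ j)"
      by (rule sum.mono_neutral_right) (auto simp: emb_def)
    also have "\<dots> = (\<Sum>j<?m. H $$ (i, ?p j) * emb y $ ?p j)"
      by (rule sum.reindex_bij_betw[OF bij, symmetric])
    also have "\<dots> = (\<Sum>j<?m. ?A $$ (i, j) * y $ j)"
      by (rule sum.cong) (auto simp: A'_index[OF i] emb_pick)
    also have "\<dots> = (?A *\<^sub>v y) $ i"
      using A' i y by (simp add: scalar_prod_def atLeast0LessThan)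
    finally show "(H *\<^sub>v emb y) $ i = (?A *\<^sub>v y) $ i" .
  qed
  have emb_supp: "vec_supp (emb y) = ?p ` vec_supp y" if y: "y \<in> carrier_vec ?m" for y
  proof -
    have "vec_supp (emb y) = {j \<in> {..<n} - S. emb y $ j \<noteq> 0}"
      by (auto simp: vec_supp_def emb_def)
    also have "{..<n} - S = ?p ` {..<?m}" using bij by (simp add: bij_betw_def)
    also have "{j \<in> ?p ` {..<?m}. emb y $ j \<noteq> 0} = ?p ` vec_supp y"
      using y by (auto simp: vec_supp_def emb_pick)
    finally show ?thesis .
  qed
  have emb_weight: "hweight (emb y) = hweight y" if y: "y \<in> carrier_vec ?m" for y
    using inj_on_subset[OF bij_betw_imp_inj_on[OF bij] vec_supp_subset[OF y]]
    by (simp add: hweight_eq_card_supp emb_supp[OF y] card_image)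
  show "mds_matrix r ?m ?A"
  proof
    show "?A \<in> carrier_mat r ?m" by fact
    fix y assume y: "y \<in> mat_kernel ?A" "y \<noteq> 0\<^sub>v ?m"
    have yc: "y \<in> carrier_vec ?m" "?A *\<^sub>v y = 0\<^sub>v r" using mat_kernelD[OF A' y(1)] by auto
    have "emb y \<in> mat_kernel H"
      using A emb_carrier emb_mult[OF yc(1)] yc(2) by (intro mat_kernelI) auto
    moreover have "emb y \<noteq> 0\<^sub>v n"
      using y(2) emb_weight[OF yc(1)] hweight_eq_0_iff[OF yc(1)] hweight_eq_0_iff[OF emb_carrier] by metis
    ultimately show "r < hweight y"
      using kernel_weight emb_weight[OF yc(1)] by metis
  qed
  show "r \<le> hweight y" if s: "s \<in> S" and y: "y \<in> fiber ?A (col H s)"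
  proof -
    have sn: "s < n" using s S by auto
    have yc: "y \<in> carrier_vec ?m" "?A *\<^sub>v y = col H s"
      using y A' by (auto simp: fiber_def)
    \<comment> \<open>The zero filled in at \<open>s\<close> makes the entry of \<open>u\<close>
      there -1, so \<open>u\<close> is a nonzero kernel word and weighs more than
      \<open>r\<close>.\<close>
    define u where "u = emb y - unit_vec n s"
    have u: "u \<in> carrier_vec n" by (simp add: u_def emb_def)
    have "H *\<^sub>v unit_vec n s = col H s"
      using A sn by (intro eq_vecI) auto
    then have "u \<in> mat_kernel H"
      using A u emb_carrier emb_mult[OF yc(1)] yc(2)
      by (intro mat_kernelI[OF A]) (auto simp: u_def mult_diff)
    moreover have "u $ s \<noteq> (0\<^sub>v n :: 'a vec) $ s" using sn s by (simp add: u_def emb_def)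
    then have "u \<noteq> 0\<^sub>v n" by metis
    ultimately have "r < hweight u" by (rule kernel_weight)
    moreover have "u \<in> vecs_on n (insert s (vec_supp (emb y)))"
      using u by (auto simp: vecs_on_def vec_supp_def u_def unit_vec_def emb_def split: if_splits)
    then have "hweight u \<le> card (insert s (vec_supp (emb y)))"
      by (rule hweight_le) simp
    then have "hweight u \<le> Suc (hweight y)"
      by (metis (no_types) card_insert_if emb_weight[OF yc(1)] finite_vec_supp
          hweight_eq_card_supp le_SucI)
    ultimately show ?thesis by simp
  qed
qed

section \<open>From MDS codes to matrices and back\<close>

text \<open>The weight of a word is its distance to the zero codeword, and the MDS condition gives
  \<open>d = (n - k) + 1\<close>.\<close>

lemma mds_matrix_of_parity_check:
  assumes "mds_code q n k d C" "parity_check_matrix n k C H"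
  shows "mds_matrix (n - k) n H"
proof
  show H: "H \<in> carrier_mat (n - k) n" using assms by (simp add: parity_check_matrix_def)
  fix y assume y: "y \<in> mat_kernel H" "y \<noteq> 0\<^sub>v n"
  have yc: "y \<in> carrier_vec n" using mat_kernelD[OF H y(1)] by simp
  have "0\<^sub>v n \<in> mat_kernel H" using H by (intro mat_kernelI) auto
  then have "d \<le> hdist y (0\<^sub>v n)"
    using assms y by (auto simp: mds_code_def linear_code_def has_min_dist_def parity_check_matrix_def)
  then show "n - k < hweight y"
    using assms(1) yc by (simp add: mds_code_def hdist_eq_hweight[OF yc])
qed

theorem theorem7p6:
  fixes C :: "'a::{field,finite} vec set"
    and H :: "'a mat"
    and S :: "nat set"
    and q n k d \<Delta> :: nat
  assumes "mds_code q n k d C"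
    and "d \<ge> 3"
    and "covering_radius n C = d - 2"
    and "parity_check_matrix n k C H"
    and "1 \<le> \<Delta>" and "\<Delta> \<le> n - d"
    and "S \<subseteq> {..<n}" and "card S = \<Delta>"
  shows "\<exists>C\<^sub>\<Delta>.
    parity_check_matrix (n - \<Delta>) (k - \<Delta>) C\<^sub>\<Delta> (submatrix H UNIV (- S)) \<and>
    mds_code q (n - \<Delta>) (k - \<Delta>) d C\<^sub>\<Delta> \<and>
    covering_radius (n - \<Delta>) C\<^sub>\<Delta> = d - 1 \<and>
    (\<forall>V \<in> code_cosets (n - \<Delta>) C\<^sub>\<Delta>. coset_weight V = d - 1 \<longrightarrow>
      (\<forall>w \<le> d - 2. weight_count w V = 0) \<and>
      weight_count (d - 1) V = (n - \<Delta>) choose (d - 1) \<and>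
      (\<forall>w \<in> {d..n - \<Delta>}.
        int (weight_count w V) = int (weight_count w C\<^sub>\<Delta>) - Omega w 0 (n - \<Delta>) d))"
proof -
  define r m where "r = n - k" and "m = n - \<Delta>"
  let ?A = "submatrix H UNIV (- S)"
  have d: "d = r + 1" using assms(1) by (simp add: mds_code_def r_def)
  have q: "q = CARD('a)" using assms(1) by (simp add: mds_code_def linear_code_def)
  \<comment> \<open>Length and dimension both drop by \<open>\<Delta>\<close>, so the redundancy
    \<open>r\<close> stays the same. From \<open>d \<ge> 3\<close> follows \<open>k < n\<close>,
    hence \<open>n - d = k - 1\<close> and \<open>\<Delta> < k\<close>: no subtraction
    truncates.\<close>
  have r: "1 \<le> r" "r < m" "m - r = k - \<Delta>" "n - \<Delta> - (k - \<Delta>) = r"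
    using assms(2,5,6) d by (auto simp: r_def m_def)
  have H: "mds_matrix r n H"
    unfolding r_def using assms(1,4) by (rule mds_matrix_of_parity_check)
  interpret mds_matrix r m ?A
    using remove_columns(1)[OF H assms(7)] by (simp add: m_def assms(8))
  \<comment> \<open>Any removed column serves as a syndrome whose solutions all have weight at least
    \<open>r\<close>.\<close>
  obtain s where s: "s \<in> S" using assms(5,8) by fastforce
  have col: "col H s \<in> carrier_vec r"
    using mds_matrix.A[OF H] by (auto simp: col_def)
  have "parity_check_matrix (n - \<Delta>) (k - \<Delta>) (mat_kernel ?A) ?A"
    using A r(4) by (simp add: parity_check_matrix_def m_def)
  moreover have "mds_code q m (k - \<Delta>) d (mat_kernel ?A)"
    using mds_code_kernel[OF r(2,1)] by (simp add: q d r(3))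
  moreover have "covering_radius m (mat_kernel ?A) = d - 1"
    using covering_radius_kernel[OF _ col remove_columns(2)[OF H assms(7) s]] r(2) d by simp
  \<comment> \<open>As \<open>d = r + 1\<close>, the three ranges of \<open>w\<close> are
    \<open>w < r\<close>, \<open>w = r\<close> and \<open>w > r\<close>.\<close>
  moreover have "(\<forall>w \<le> d - 2. weight_count w V = 0) \<and>
      weight_count (d - 1) V = m choose (d - 1) \<and>
      (\<forall>w \<in> {d..m}. int (weight_count w V) = int (weight_count w (mat_kernel ?A)) - Omega w 0 m d)"
    if "V \<in> code_cosets m (mat_kernel ?A)" "coset_weight V = d - 1" for V
    using weight_distribution[OF r(1) that(1)] that(2) r(1) d by auto
  ultimately show ?thesis by (auto simp: m_def)
qed

end
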